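(* Let $\mathcal G$ be a finite simple undirected graph with vertex set $\mathcal X$, and let $\mathcal O\subseteq\mathcal X$. Assume that every $x\in\mathcal X\setminus\mathcal O$ has at least two neighbors. Consider the system for $b\colon\mathcal X\to\mathbb R$ $$\begin{cases}b(x)\ge\dfrac{b(y_1)+b(y_2)}2+1,&x\in\mathcal X\setminus\mathcal O,\\ b(x)\ge0,&x\in\mathcal O,\end{cases}$$ where, for each $x\in\mathcal X\setminus\mathcal O$, $y_1,y_2\in\mathcal N_x$ are two distinct neighbors of $x$ such that $b(y_1)\ge b(y_2)\ge b(y)$ for all $y\in\mathcal N_x\setminus\{y_1,y_2\}$ (i.e. $b(y_1),b(y_2)$ are the two largest values of $b$ on $\mathcal N_x$). Then there exists a function $b\colon\mathcal X\to\mathbb R$ satisfying this system if and only if for every nonempty $S\subseteq\mathcal X\setminus\mathcal O$ there exists $x\in S$ such that $|\mathcal N_x\cap S|\le1$.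
   Context: $\mathcal N_x$ denotes the set of neighbors of the vertex $x$ in $\mathcal G$. *)

theory Defs
  imports Complex_Main "Graph_Theory.Digraph"
begin

(* Undirected graphs are symmetric digraphs, as in Graph_Theory: the locale predicate
   graph says finite, loop-free, without parallel arcs, and symmetric, so that every
   undirected edge is a pair of opposite arcs. *)

definition neighbors :: "('a, 'b) pre_digraph \<Rightarrow> 'a \<Rightarrow> 'a set" where
  "neighbors G x = {y. x \<rightarrow>\<^bsub>G\<^esub> y}"

definition two_largest ::
    "('a, 'b) pre_digraph \<Rightarrow> ('a \<Rightarrow> real) \<Rightarrow> 'a \<Rightarrow> 'a \<Rightarrow> 'a \<Rightarrow> bool" where
  "two_largest G b x y1 y2 \<longleftrightarrow>
     y1 \<in> neighbors G x \<and> y2 \<in> neighbors G x \<and> y1 \<noteq> y2 \<and>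
     b y1 \<ge> b y2 \<and> (\<forall>y \<in> neighbors G x - {y1, y2}. b y2 \<ge> b y)"

(* Only the values of b on verts G matter. In case of ties the pair y1, y2 is not unique;
   by satisfies_system_iff_all below, the choice is irrelevant. *)
definition satisfies_system ::
    "('a, 'b) pre_digraph \<Rightarrow> 'a set \<Rightarrow> ('a \<Rightarrow> real) \<Rightarrow> bool" where
  "satisfies_system G O' b \<longleftrightarrow>
     (\<forall>x \<in> verts G - O'. \<exists>y1 y2. two_largest G b x y1 y2 \<and> b x \<ge> (b y1 + b y2) / 2 + 1) \<and>
     (\<forall>x \<in> O'. b x \<ge> 0)"

lemma two_largest_sum_unique:
  assumes "two_largest G b x y1 y2" and "two_largest G b x z1 z2"
  shows "b y1 + b y2 = b z1 + b z2"
proof -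
  have le: "b v1 \<le> b u1 \<and> b v2 \<le> b u2"
    if "two_largest G b x u1 u2" "two_largest G b x v1 v2" for u1 u2 v1 v2
  proof -
    have u: "b u2 \<le> b u1" "\<And>v. v \<in> neighbors G x \<Longrightarrow> v = u1 \<or> v = u2 \<or> b v \<le> b u2"
      using that(1) unfolding two_largest_def by auto
    have v: "v1 \<in> neighbors G x" "v2 \<in> neighbors G x" "v1 \<noteq> v2" "b v2 \<le> b v1"
      using that(2) unfolding two_largest_def by auto
    show ?thesis using u(1) u(2)[OF v(1)] u(2)[OF v(2)] v(3,4) by auto
  qed
  show ?thesis using le[OF assms] le[OF assms(2,1)] by linarith
qed

lemma finite_has_maximizer:
  fixes b :: "'a \<Rightarrow> real"
  assumes "finite N" and "N \<noteq> {}"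
  shows "\<exists>m \<in> N. \<forall>y \<in> N. b y \<le> b m"
proof -
  have "Max (b ` N) \<in> b ` N" using assms by (intro Max_in) auto
  then obtain m where m: "m \<in> N" "b m = Max (b ` N)" by auto
  have "\<forall>y \<in> N. b y \<le> b m" unfolding m(2) using assms(1) by simp
  with m(1) show ?thesis by blast
qed

lemma two_largest_exists:
  assumes "finite (neighbors G x)" and "card (neighbors G x) \<ge> 2"
  shows "\<exists>y1 y2. two_largest G b x y1 y2"
proof -
  let ?N = "neighbors G x"
  have "?N \<noteq> {}" using assms(2) by auto
  from finite_has_maximizer[OF assms(1) this, of b]
  obtain y1 where y1: "y1 \<in> ?N" "\<forall>y \<in> ?N. b y \<le> b y1" by blast
  have "card (?N - {y1}) \<noteq> 0" using assms y1(1) by simp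
  then have ne: "?N - {y1} \<noteq> {}" by (metis card.empty)
  have "finite (?N - {y1})" using assms(1) by simp
  from finite_has_maximizer[OF this ne, of b]
  obtain y2 where "y2 \<in> ?N - {y1}" "\<forall>y \<in> ?N - {y1}. b y \<le> b y2" by blast
  with y1 have "two_largest G b x y1 y2" unfolding two_largest_def by blast
  then show ?thesis by blast
qed

lemma satisfies_system_iff_all:
  assumes "graph G"
    and "\<And>x. x \<in> verts G - O' \<Longrightarrow> card (neighbors G x) \<ge> 2"
  shows "satisfies_system G O' b \<longleftrightarrow>
     (\<forall>x \<in> verts G - O'. \<forall>y1 y2. two_largest G b x y1 y2 \<longrightarrow> b x \<ge> (b y1 + b y2) / 2 + 1) \<and>
     (\<forall>x \<in> O'. b x \<ge> 0)"
proof -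
  interpret graph G by fact
  have fin: "finite (neighbors G x)" for x
    by (rule finite_subset[of _ "verts G"]) (auto simp: neighbors_def dest: adj_in_verts)
  have "(\<exists>y1 y2. two_largest G b x y1 y2 \<and> b x \<ge> (b y1 + b y2) / 2 + 1) \<longleftrightarrow>
      (\<forall>y1 y2. two_largest G b x y1 y2 \<longrightarrow> b x \<ge> (b y1 + b y2) / 2 + 1)"
    if x: "x \<in> verts G - O'" for x
  proof -
    obtain z1 z2 where z: "two_largest G b x z1 z2"
      using two_largest_exists[OF fin assms(2)[OF x]] by blast
    have "b x \<ge> (b y1 + b y2) / 2 + 1 \<longleftrightarrow> b x \<ge> (b z1 + b z2) / 2 + 1"
      if "two_largest G b x y1 y2" for y1 y2
      by (simp only: two_largest_sum_unique[OF that z])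
    with z show ?thesis by blast
  qed
  then show ?thesis unfolding satisfies_system_def by simp
qed

end

theory Submission
  imports Defs
begin

text \<open>
  If every vertex of a nonempty \<open>S\<close> disjoint from \<open>O'\<close> had two neighbors in \<open>S\<close>, then at a
  minimizer of \<open>b\<close> on \<open>S\<close> the two largest neighboring values would average to at least \<open>b x\<close>,
  contradicting the system. Conversely, peeling off vertices with at most one remaining neighbor
  gives a ranking \<open>r\<close>, zero on \<open>O'\<close>, for which each \<open>x\<close> outside \<open>O'\<close> has at most one neighbor
  of rank at least \<open>r x\<close>. With \<open>C = 2 ^ (n + 1)\<close> and \<open>n\<close> the maximal rank,
  \<open>b x = C - C / 2 ^ r x\<close> is a solution: every value is at most \<open>C - 2\<close>, and one of the
  two largest neighboring values is at most \<open>C - 2 * (C - b x)\<close>.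
\<close>

lemma neighbors_subset_verts:
  assumes "graph G"
  shows "neighbors G x \<subseteq> verts G"
proof -
  interpret graph G by fact
  show ?thesis by (auto simp: neighbors_def dest: adj_in_verts)
qed

text \<open>Of two distinct neighbors at most one is \<open>y1\<close>, so the other has value at
  most \<open>b y2\<close>; no neighbor exceeds \<open>b y1\<close>.\<close>

lemma two_largest_ge:
  assumes "two_largest G b x y1 y2" "u \<in> neighbors G x" "v \<in> neighbors G x" "u \<noteq> v"
  shows "b u + b v \<le> b y1 + b y2"
proof -
  have y: "b y2 \<le> b y1" "\<And>w. w \<in> neighbors G x \<Longrightarrow> w = y1 \<or> w = y2 \<or> b w \<le> b y2"
    using assms(1) unfolding two_largest_def by auto
  show ?thesis using y(1) y(2)[OF assms(2)] y(2)[OF assms(3)] assms(4) by auto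
qed

lemma card_gt_1_obtain:
  assumes "\<not> card A \<le> 1"
  obtains u v where "u \<in> A" "v \<in> A" "u \<noteq> v"
proof -
  \<comment> \<open>An infinite set has \<open>card\<close> 0, contrary to the assumption.\<close>
  have "finite A" using assms by (rule contrapos_np) simp
  then show thesis using assms that by (auto simp: card_le_Suc0_iff_eq)
qed

lemma satisfies_system_imp_sparse:
  assumes "finite S" "S \<noteq> {}" "S \<subseteq> verts G - O'" "satisfies_system G O' b"
  shows "\<exists>x \<in> S. card (neighbors G x \<inter> S) \<le> 1"
proof (rule ccontr)
  assume dense: "\<not> ?thesis"
  obtain x where x: "x \<in> S" "\<forall>y \<in> S. b x \<le> b y"
    using finite_has_maximizer[OF assms(1,2), of "\<lambda>y. - b y"] by auto
  from dense x(1) obtain u v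
    where uv: "u \<in> neighbors G x \<inter> S" "v \<in> neighbors G x \<inter> S" "u \<noteq> v"
    by (meson card_gt_1_obtain)
  obtain y1 y2 where y: "two_largest G b x y1 y2" "b x \<ge> (b y1 + b y2) / 2 + 1"
    using assms(3,4) x(1) unfolding satisfies_system_def by blast
  have "b u + b v \<le> b y1 + b y2" using two_largest_ge[OF y(1)] uv by blast
  moreover have "b x \<le> b u" "b x \<le> b v" using x(2) uv by auto
  ultimately show False using y(2) by argo
qed

text \<open>Ranks record the order of peeling: a vertex removed earlier gets a smaller positive
  rank, so the neighbors of rank at least \<open>r x\<close> lie in the set from which
  \<open>x\<close> was peeled.\<close>

lemma peeling_rank_exists:
  fixes N :: "'a \<Rightarrow> 'a set"
  assumes "finite S" "\<And>T. T \<subseteq> S \<Longrightarrow> T \<noteq> {} \<Longrightarrow> \<exists>x \<in> T. card (N x \<inter> T) \<le> 1"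
  shows "\<exists>r :: 'a \<Rightarrow> nat. (\<forall>x. x \<notin> S \<longrightarrow> r x = 0) \<and>
    (\<forall>x \<in> S. 0 < r x \<and> card {y \<in> N x. r x \<le> r y} \<le> 1)"
  using assms
proof (induction S rule: finite_psubset_induct)
  case (psubset S)
  show ?case
  proof (cases "S = {}")
    case True
    then show ?thesis by auto
  next
    case False
    then obtain x where x: "x \<in> S" "card (N x \<inter> S) \<le> 1" using psubset.prems[of S] by blast
    have "S - {x} \<subset> S" using x(1) by blast
    moreover have "\<exists>z \<in> T. card (N z \<inter> T) \<le> 1" if "T \<subseteq> S - {x}" "T \<noteq> {}" for T
      using psubset.prems[of T] that by blast
    ultimately obtain r :: "'a \<Rightarrow> nat" where r: "\<forall>z. z \<notin> S - {x} \<longrightarrow> r z = 0"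
      "\<forall>z \<in> S - {x}. 0 < r z \<and> card {y \<in> N z. r z \<le> r y} \<le> 1"
      using psubset.IH[of "S - {x}"] by blast
    \<comment> \<open>The shift moves \<open>x\<close> from rank 0 to rank 1, the other points of
      \<open>S\<close> to ranks at least 2, and leaves rank 0 outside \<open>S\<close>.\<close>
    define r' where "r' z = (if z \<in> S then Suc (r z) else 0)" for z
    have "card {y \<in> N z. r' z \<le> r' y} \<le> 1" if z: "z \<in> S" for z
    proof (cases "z = x")
      case True
      have "r x = 0" using r(1) by blast
      then have "{y \<in> N x. r' x \<le> r' y} = N x \<inter> S" using x(1) by (auto simp: r'_def)
      then show ?thesis using x(2) unfolding True by (simp only:)
    next
      case False
      then have rz: "0 < r z" "card {y \<in> N z. r z \<le> r y} \<le> 1" using z r(2) by blast+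
      \<comment> \<open>As \<open>0 < r z\<close>, both sides fail for \<open>y = x\<close> and for
        \<open>y\<close> outside \<open>S\<close>.\<close>
      have "r' z \<le> r' y \<longleftrightarrow> r z \<le> r y" for y
        using z rz(1) r(1)[rule_format, of y] by (cases "y \<in> S") (simp_all add: r'_def)
      then show ?thesis using rz(2) by (simp only:)
    qed
    moreover have "r' z = 0" if "z \<notin> S" for z using that by (simp add: r'_def)
    moreover have "0 < r' z" if "z \<in> S" for z using that by (simp add: r'_def)
    ultimately show ?thesis by (intro exI[of _ r'] conjI allI ballI impI)
  qed
qed

lemma rank_imp_satisfies_system:
  fixes r :: "'a \<Rightarrow> nat"
  assumes "graph G" "\<And>x. x \<in> verts G - O' \<Longrightarrow> card (neighbors G x) \<ge> 2"
    and rank: "\<And>x. x \<in> verts G - O' \<Longrightarrow> card {y \<in> neighbors G x. r x \<le> r y} \<le> 1"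
  shows "\<exists>b. satisfies_system G O' b"
proof -
  interpret graph G by fact
  define n where "n = Max (r ` verts G)"
  \<comment> \<open>This makes the gap \<open>C - b x = C / 2 ^ r x\<close> at least 2 on all
    vertices; the gap halves with each rank.\<close>
  define C :: real where "C = 2 ^ (n + 1)"
  define b where "b x = C - C / 2 ^ r x" for x
  have C0: "0 \<le> C" by (simp add: C_def)
  have b_nonneg: "0 \<le> b x" for x
  proof -
    have "C / 2 ^ r x \<le> C / 1" using C0 by (intro divide_left_mono) auto
    then show ?thesis by (simp add: b_def)
  qed
  have b_le: "b y \<le> C - 2" if "y \<in> verts G" for y
  proof -
    have "r y \<le> n" using that by (simp add: n_def)
    then have "(2::real) ^ r y \<le> 2 ^ n" by (simp add: power_increasing)
    then show ?thesis by (simp add: b_def C_def le_divide_eq)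
  qed
  have b_lower: "b y \<le> C - 2 * (C / 2 ^ r x)" if "r y < r x" for x y
  proof -
    have "C / 2 ^ (r x - 1) \<le> C / 2 ^ r y"
      using that C0 by (intro divide_left_mono power_increasing) auto
    moreover have "(2::real) ^ r x = 2 * 2 ^ (r x - 1)"
      using that by (cases "r x") simp_all
    ultimately show ?thesis by (simp add: b_def)
  qed
  have "(b y1 + b y2) / 2 + 1 \<le> b x"
    if x: "x \<in> verts G - O'" and y: "two_largest G b x y1 y2" for x y1 y2
  proof -
    have N: "y1 \<in> neighbors G x" "y2 \<in> neighbors G x" "y1 \<noteq> y2"
      using y by (auto simp: two_largest_def)
    then have V: "y1 \<in> verts G" "y2 \<in> verts G" using neighbors_subset_verts[OF assms(1)] by auto
    \<comment> \<open>Without finiteness, \<open>card\<close> at most 1 would not exclude two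
      distinct elements.\<close>
    have "finite {y \<in> neighbors G x. r x \<le> r y}"
      using finite_subset[OF neighbors_subset_verts[OF assms(1)]] by simp
    then have "r y1 < r x \<or> r y2 < r x"
      using rank[OF x] N by (auto simp: card_le_Suc0_iff_eq not_le[symmetric])
    \<comment> \<open>Half of this bound plus 1 is exactly \<open>b x\<close>: the 2 from the first
      summand pays for the 1 in the system.\<close>
    then have "b y1 + b y2 \<le> (C - 2) + (C - 2 * (C / 2 ^ r x))"
      using b_lower[of y1 x] b_lower[of y2 x] b_le[OF V(1)] b_le[OF V(2)] by linarith
    then show ?thesis unfolding b_def[of x] by argo
  qed
  then have "satisfies_system G O' b"
    using b_nonneg satisfies_system_iff_all[OF assms(1,2)] by blast
  then show ?thesis by blast
qed

theorem theorem3p10: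
  fixes G :: "('a, 'b) pre_digraph" and O' :: "'a set"
  assumes "graph G"
    and "O' \<subseteq> verts G"
    and "\<And>x. x \<in> verts G - O' \<Longrightarrow> card (neighbors G x) \<ge> 2"
  shows "(\<exists>b :: 'a \<Rightarrow> real. satisfies_system G O' b) \<longleftrightarrow>
    (\<forall>S. S \<subseteq> verts G - O' \<and> S \<noteq> {} \<longrightarrow> (\<exists>x \<in> S. card (neighbors G x \<inter> S) \<le> 1))"
proof -
  interpret graph G by fact
  have fin: "finite (verts G - O')" by simp
  show ?thesis
  proof
    assume "\<exists>b :: 'a \<Rightarrow> real. satisfies_system G O' b"
    then show "\<forall>S. S \<subseteq> verts G - O' \<and> S \<noteq> {} \<longrightarrow> (\<exists>x \<in> S. card (neighbors G x \<inter> S) \<le> 1)"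
      using satisfies_system_imp_sparse finite_subset[OF _ fin] by metis
  next
    assume "\<forall>S. S \<subseteq> verts G - O' \<and> S \<noteq> {} \<longrightarrow> (\<exists>x \<in> S. card (neighbors G x \<inter> S) \<le> 1)"
    then obtain r :: "'a \<Rightarrow> nat"
      where "\<forall>x \<in> verts G - O'. 0 < r x \<and> card {y \<in> neighbors G x. r x \<le> r y} \<le> 1"
      using peeling_rank_exists[OF fin, of "neighbors G"] by blast
    then show "\<exists>b :: 'a \<Rightarrow> real. satisfies_system G O' b"
      using rank_imp_satisfies_system[OF assms(1,3)] by blast
  qed
qed

end
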